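(* Let $\varepsilon,\tau>0$ and assume that $f:\mathbb{R}^2\to\mathbb{C}$ satisfies $$|f(\xi)|\le|\xi_1|^{2+\varepsilon}e^{-\tau|\xi|},\qquad \xi=(\xi_1,\xi_2)\in\mathbb{R}^2.$$ Then $$\|f\|_*=\operatorname*{ess\,sup}_{\xi\in\mathbb{R}^2}\sum_{j\ge1}\sum_{k=0}^{2^j-1}|f(B_{j,k}\xi)|\le C,$$ where the constant $C<\infty$ depends only on $\tau$ and $\varepsilon$.
   Context: Here $|\xi|$ is the Euclidean norm on $\mathbb{R}^2$ and, for $j\ge1$ and $0\le k\le2^j-1$, $$B_{j,k}=D_j^{-1}R_{2k\pi/2^j},\qquad D_j=\begin{bmatrix}4^j&0\\0&2^j\end{bmatrix},\qquad R_\theta=\begin{bmatrix}\cos\theta&-\sin\theta\\ \sin\theta&\cos\theta\end{bmatrix}.$$ The essential supremum is with respect to Lebesgue measure. *)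

theory Defs
  imports "HOL-Analysis.Analysis" "HOL-Probability.Essential_Supremum"
begin

definition dil :: "nat \<Rightarrow> real^2^2" where
  "dil j = vector [vector [4 ^ j, 0], vector [0, 2 ^ j]]"

definition rot :: "real \<Rightarrow> real^2^2" where
  "rot \<theta> = vector [vector [cos \<theta>, - sin \<theta>], vector [sin \<theta>, cos \<theta>]]"

definition B :: "nat \<Rightarrow> nat \<Rightarrow> real^2^2" where
  "B j k = matrix_inv (dil j) ** rot (2 * real k * pi / 2 ^ j)"

text \<open>
  The essential supremum, defined for arbitrary functions. The library's \<open>esssup\<close> takes
  the value \<open>\<top>\<close> on every function that is not Borel measurable; below no measurability is
  assumed, so the usual definition is applied without that proviso.
\<close>
definition ess_sup :: "'a measure \<Rightarrow> ('a \<Rightarrow> ennreal) \<Rightarrow> ennreal" where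
  "ess_sup M g = Inf {c. AE x in M. g x \<le> c}"

lemma ess_sup_eq_esssup: "g \<in> borel_measurable M \<Longrightarrow> ess_sup M g = esssup M g"
  by (simp add: ess_sup_def esssup_eq_AE)

definition star_norm :: "(real^2 \<Rightarrow> complex) \<Rightarrow> ennreal" where
  "star_norm f = ess_sup lebesgue
     (\<lambda>\<xi>. \<Sum>\<^sub>\<infinity>j\<in>{1..}. \<Sum>k=0..2 ^ j - 1. ennreal (norm (f (B j k *v \<xi>))))"

end

theory Submission
  imports Defs
begin

text \<open>
  Write \<open>\<xi> = r (cos \<phi>, sin \<phi>)\<close> and \<open>s = r / 4 ^ j\<close>. Then
  \<open>B j k \<xi> = (s cos \<alpha>, 2 ^ j s sin \<alpha>)\<close> with \<open>\<alpha> = \<phi> + 2 \<pi> k / 2 ^ j\<close>, and its norm is at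
  least \<open>(s + 2 ^ j s \<bar>sin \<alpha>\<bar>) / 4\<close>. Since the angles \<open>\<alpha>\<close> are equidistributed, Jordan's
  inequality for the sine bounds the sum over \<open>k\<close> by a geometric series, and it is at most
  \<open>K s / (1 + s)\<^sup>2\<close>. With \<open>G s = s / (1 + s)\<close> this is bounded by a multiple of
  \<open>G (4 s) - G s\<close>, so the sum over \<open>j\<close> telescopes.
\<close>

section \<open>Exponential sums over equidistributed angles\<close>

text \<open>Raising the shift by one drops \<open>F i\<close> and adds \<open>F (i + M)\<close>,
  which are equal. This allows the starting angle to be reduced modulo the spacing of the
  angles.\<close>

lemma sum_shift_periodic:
  fixes F :: "nat \<Rightarrow> 'a::ab_group_add"
  assumes "\<And>k. F (k + M) = F k"
  shows "(\<Sum>k<M. F (k + i)) = (\<Sum>k<M. F k)"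
proof (induction i)
  case (Suc i)
  have "(\<Sum>k<M. F (k + Suc i)) + F i = (\<Sum>k<Suc M. F (k + i))"
    by (subst sum.lessThan_Suc_shift) (simp add: add.commute)
  also have "\<dots> = (\<Sum>k<M. F (k + i)) + F i"
    using assms[of i] by (simp add: add.commute)
  finally show ?case
    using Suc.IH by simp
qed simp

text \<open>Jordan's inequality: the sine is concave on [0, pi/2], hence lies above its
  chord.\<close>

lemma sin_ge_jordan:
  fixes x :: real
  assumes "0 \<le> x" "x \<le> pi / 2"
  shows "2 * x / pi \<le> sin x"
proof -
  have "concave_on {0..pi / 2} sin"
    by (rule f''_le0_imp_concave[where f' = cos and f'' = "\<lambda>x. - sin x"])
      (auto intro!: derivative_eq_intros sin_ge_zero)
  from concave_onD_Icc'[OF this, of x] show ?thesis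
    using assms by simp
qed

text \<open>The angle lies in [0, pi], at distance at least pi k / M from 0 and at least pi (M - 1 -
  k) / M from pi; the 1 is lost because \<open>\<phi>\<close> may be as large as pi / M. Jordan's
  inequality applies to the angle or, past pi/2, to its reflection.\<close>

lemma sin_equidistributed_ge:
  fixes \<phi> :: real
  assumes "0 \<le> \<phi>" "\<phi> \<le> pi / real M" "k < M"
  shows "2 * real (min k (M - 1 - k)) / real M \<le> sin (\<phi> + pi * real k / real M)"
proof (cases "\<phi> + pi * real k / real M \<le> pi / 2")
  case True
  have "2 * real (min k (M - 1 - k)) / real M \<le> 2 * (pi * real k / real M) / pi"
    using assms by (simp add: divide_right_mono)
  also have "\<dots> \<le> 2 * (\<phi> + pi * real k / real M) / pi"
    using assms by (intro divide_right_mono) auto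
  also have "\<dots> \<le> sin (\<phi> + pi * real k / real M)"
    using assms True by (intro sin_ge_jordan) auto
  finally show ?thesis .
next
  case False
  have eq: "pi - pi / real M - pi * real k / real M = pi * real (M - 1 - k) / real M"
    using assms by (simp add: field_simps of_nat_diff)
  have "0 \<le> pi * real (M - 1 - k) / real M"
    by simp
  with eq have nn: "0 \<le> pi - (\<phi> + pi * real k / real M)"
    using assms by linarith
  from eq have le: "pi * real (M - 1 - k) / real M \<le> pi - (\<phi> + pi * real k / real M)"
    using assms by linarith
  have "2 * real (min k (M - 1 - k)) / real M \<le> 2 * (pi * real (M - 1 - k) / real M) / pi"
    using assms by (simp add: divide_right_mono)
  also have "\<dots> \<le> 2 * (pi - (\<phi> + pi * real k / real M)) / pi"
    using le by (intro divide_right_mono mult_left_mono) auto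
  also have "\<dots> \<le> sin (pi - (\<phi> + pi * real k / real M))"
    using assms False nn by (intro sin_ge_jordan) auto
  finally show ?thesis
    by (simp only: sin_pi_minus)
qed

text \<open>The full geometric series has sum 1 / (1 - exp (-x)), and exp (-x) is at most 1 / (1 +
  x).\<close>

lemma geometric_exp_le:
  fixes x :: real
  assumes "0 < x"
  shows "(\<Sum>k<n. exp (- x * real k)) \<le> 1 + 1 / x"
proof -
  have lt: "exp (- x) < 1"
    using assms by auto
  have "(\<Sum>k<n. exp (- x * real k)) = (\<Sum>k<n. exp (- x) ^ k)"
    by (simp add: exp_of_nat_mult[symmetric] mult.commute)
  also have "\<dots> = (1 - exp (- x) ^ n) / (1 - exp (- x))"
    using lt by (subst sum_gp_strict) auto
  also have "\<dots> \<le> 1 / (1 - exp (- x))"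
    using lt by (intro divide_right_mono) auto
  also have "\<dots> \<le> 1 / (x / (1 + x))"
  proof (rule divide_left_mono)
    have "exp (- x) \<le> 1 / (1 + x)"
      using assms exp_ge_add_one_self[of x] by (simp add: exp_minus field_simps)
    then show "x / (1 + x) \<le> 1 - exp (- x)"
      using assms by (simp add: field_simps)
  qed (use assms lt in auto)
  also have "\<dots> = 1 + 1 / x"
    using assms by (simp add: field_simps)
  finally show ?thesis .
qed

text \<open>Since |sin| has period pi, the full circle counts a half circle twice. On the half
  circle the angles move away from both zeros of the sine in equal steps, giving two geometric
  series; hence the factor 4.\<close>

lemma sum_exp_abs_sin_le:
  fixes \<phi> a :: real
  assumes "0 < a" "0 < M" "0 \<le> \<phi>"
  shows "(\<Sum>k<2 * M. exp (- a * \<bar>sin (\<phi> + pi * real k / real M)\<bar>)) \<le> 4 * (1 + real M / (2 * a))"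
proof -
  \<comment> \<open>\<open>i\<close> is the number of whole steps pi / M in \<open>\<phi>\<close>,
    and \<open>\<psi>\<close> is the remainder.\<close>
  define i where "i = nat \<lfloor>\<phi> * real M / pi\<rfloor>"
  define \<psi> where "\<psi> = \<phi> - pi * real i / real M"
  define F where "F k = exp (- a * \<bar>sin (\<psi> + pi * real k / real M)\<bar>)" for k
  have i: "real i \<le> \<phi> * real M / pi" "\<phi> * real M / pi < real i + 1"
    using assms by (auto simp: i_def)
  have \<psi>: "0 \<le> \<psi>" "\<psi> \<le> pi / real M"
  proof -
    have "pi * real i / real M \<le> \<phi>"
      using i(1) assms by (simp add: field_simps)
    moreover have "\<phi> \<le> pi * (real i + 1) / real M"
      using i(2) assms by (simp add: field_simps)
    ultimately show "0 \<le> \<psi>" "\<psi> \<le> pi / real M"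
      by (simp_all add: \<psi>_def ring_distribs add_divide_distrib)
  qed
  have periodic: "F (k + M) = F k" for k
  proof -
    have "\<psi> + pi * real (k + M) / real M = (\<psi> + pi * real k / real M) + pi"
      using assms by (simp add: field_simps)
    then show ?thesis
      by (simp only: F_def sin_periodic_pi abs_minus_cancel)
  qed
  have F_shift: "exp (- a * \<bar>sin (\<phi> + pi * real k / real M)\<bar>) = F (k + i)" for k
    by (simp add: F_def \<psi>_def add_divide_distrib ring_distribs)
  have split: "(\<Sum>k<M + n. F (k + i)) = (\<Sum>k<M. F (k + i)) + (\<Sum>k<n. F (k + (M + i)))" for n
    by (induction n) (simp_all add: add_ac)
  have "(\<Sum>k<2 * M. exp (- a * \<bar>sin (\<phi> + pi * real k / real M)\<bar>)) = (\<Sum>k<M + M. F (k + i))"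
    by (simp only: F_shift mult_2)
  also have "\<dots> = (\<Sum>k<M. F (k + i)) + (\<Sum>k<M. F (k + (M + i)))"
    by (rule split)
  also have "\<dots> = 2 * (\<Sum>k<M. F k)"
    by (simp only: sum_shift_periodic[of F M, OF periodic])
  also have "(\<Sum>k<M. F k) \<le> (\<Sum>k<M. exp (- (2 * a / M) * real k) + exp (- (2 * a / M) * real (M - Suc k)))"
  proof (rule sum_mono)
    fix k assume "k \<in> {..<M}"
    then have "2 * real (min k (M - 1 - k)) / real M \<le> \<bar>sin (\<psi> + pi * real k / real M)\<bar>"
      using sin_equidistributed_ge[OF \<psi>, of k] by auto
    then have "a * (2 * real (min k (M - 1 - k)) / real M) \<le> a * \<bar>sin (\<psi> + pi * real k / real M)\<bar>"
      using assms by (intro mult_left_mono) auto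
    then have "F k \<le> exp (- (2 * a / M) * real (min k (M - 1 - k)))"
      by (simp add: F_def mult_ac)
    \<comment> \<open>The exponential at the minimum is one of the two summands.\<close>
    also have "\<dots> \<le> exp (- (2 * a / M) * real k) + exp (- (2 * a / M) * real (M - Suc k))"
      by (cases "k \<le> M - 1 - k") (auto simp: min_def)
    finally show "F k \<le> \<dots>" .
  qed
  also have "\<dots> = 2 * (\<Sum>k<M. exp (- (2 * a / M) * real k))"
    using sum.nat_diff_reindex[of "\<lambda>k. exp (- (2 * a / M) * real k)" M]
    by (simp add: sum.distrib)
  also have "(\<Sum>k<M. exp (- (2 * a / M) * real k)) \<le> 1 + 1 / (2 * a / M)"
    using assms by (intro geometric_exp_le) auto
  finally show ?thesis
    by simp
qed

section \<open>Scalar estimates in the radial variable\<close>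

text \<open>This is t <= exp t at t = c s / p, raised to the power p.\<close>

lemma powr_exp_bounded:
  fixes p c s :: real
  assumes "0 < p" "0 < c" "0 \<le> s"
  shows "s powr p * exp (- c * s) \<le> (p / c) powr p"
proof -
  have "s \<le> (p / c) * exp (c * s / p)"
    using exp_ge_add_one_self[of "c * s / p"] assms by (simp add: field_simps)
  then have "s powr p \<le> ((p / c) * exp (c * s / p)) powr p"
    using assms by (intro powr_mono2) auto
  also have "\<dots> = (p / c) powr p * exp (c * s)"
    using assms by (subst powr_mult) (simp_all add: exp_powr_real)
  finally show ?thesis
    by (simp add: exp_minus field_simps)
qed

text \<open>After a factor s is split off and (1 + s)^2 is multiplied out, only the powers
  \<open>\<epsilon>\<close>, ..., \<open>\<epsilon> + 3\<close> of s remain, and the exponential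
  bounds each of them. The right-hand side has the shape that telescopes over scales.\<close>

lemma level_bound_exists:
  fixes \<epsilon> \<tau> :: real
  assumes "0 < \<epsilon>" "0 < \<tau>"
  obtains K where "0 \<le> K"
    "\<And>s. 0 < s \<Longrightarrow> s powr (2 + \<epsilon>) * exp (- (\<tau> / 4) * s) * (4 * (1 + 1 / (\<tau> * s))) \<le> K * (s / (1 + s)\<^sup>2)"
proof
  define b where "b i = ((\<epsilon> + i) / (\<tau> / 4)) powr (\<epsilon> + i)" for i
  \<comment> \<open>The coefficients are those of the polynomial (s + 1/\<open>\<tau>\<close>) (1 +
    s)^2.\<close>
  define K where "K = 4 * ((1 / \<tau>) * b 0 + (1 + 2 / \<tau>) * b 1 + (2 + 1 / \<tau>) * b 2 + b 3)"
  show "0 \<le> K"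
    using assms by (auto simp: K_def b_def)
  fix s :: real assume s: "0 < s"
  define E where "E = exp (- (\<tau> / 4) * s)"
  have b: "s powr (\<epsilon> + i) * E \<le> b i" if "0 \<le> i" for i
    unfolding E_def b_def using assms s that by (intro powr_exp_bounded) auto
  have pw: "s powr (\<epsilon> + 1) = s powr \<epsilon> * s" "s powr (\<epsilon> + 2) = s powr \<epsilon> * s ^ 2"
    "s powr (\<epsilon> + 3) = s powr \<epsilon> * s ^ 3" "s powr (2 + \<epsilon>) = s powr \<epsilon> * s ^ 2"
    using s by (simp_all add: powr_add)
  have cancel: "s\<^sup>2 * (1 + 1 / (\<tau> * s)) = s * (s + 1 / \<tau>)"
    using assms s by (simp add: field_simps power2_eq_square)
  have "s powr (2 + \<epsilon>) * E * (4 * (1 + 1 / (\<tau> * s))) * (1 + s)\<^sup>2 =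
      4 * s powr \<epsilon> * E * (s\<^sup>2 * (1 + 1 / (\<tau> * s))) * (1 + s)\<^sup>2"
    unfolding pw by (simp only: mult_ac)
  also have "\<dots> = s * (4 * ((1 / \<tau>) * (s powr (\<epsilon> + 0) * E) + (1 + 2 / \<tau>) * (s powr (\<epsilon> + 1) * E)
        + (2 + 1 / \<tau>) * (s powr (\<epsilon> + 2) * E) + s powr (\<epsilon> + 3) * E))"
    unfolding pw cancel
    by (simp add: divide_inverse algebra_simps power2_eq_square power3_eq_cube)
  also have "\<dots> \<le> s * K"
    unfolding K_def using assms s b[of 0] b[of 1] b[of 2] b[of 3]
    by (intro mult_left_mono add_mono) auto
  finally show "s powr (2 + \<epsilon>) * exp (- (\<tau> / 4) * s) * (4 * (1 + 1 / (\<tau> * s))) \<le> K * (s / (1 + s)\<^sup>2)"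
    using s by (simp add: E_def field_simps)
qed

lemma sum_powers_of_4_le:
  fixes r :: real
  assumes "0 < r"
  shows "(\<Sum>j=1..n. (r / 4 ^ j) / (1 + r / 4 ^ j)\<^sup>2) \<le> 4 / 3"
proof -
  define G where "G s = s / (1 + s)" for s :: real
  \<comment> \<open>The difference G (4 s) - G s equals 3 s / ((1 + 4 s) (1 + s)), so 4/3 cancels
    the 3 and leaves the 4 needed for 1 + 4 s <= 4 (1 + s).\<close>
  have step: "s / (1 + s)\<^sup>2 \<le> 4 / 3 * (G (4 * s) - G s)" if "0 < s" for s
  proof -
    have "4 / 3 * (G (4 * s) - G s) = 4 * s / ((1 + 4 * s) * (1 + s))"
      using that by (simp add: G_def divide_simps) (simp add: algebra_simps)
    also have "\<dots> \<ge> 4 * s / ((4 + 4 * s) * (1 + s))"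
      using that by (intro divide_left_mono mult_right_mono) auto
    also have "4 * s / ((4 + 4 * s) * (1 + s)) = s / (1 + s)\<^sup>2"
      using that by (simp add: power2_eq_square divide_simps)
    finally show ?thesis by simp
  qed
  have "(\<Sum>j=1..n. (r / 4 ^ j) / (1 + r / 4 ^ j)\<^sup>2) \<le> 4 / 3 * (G r - G (r / 4 ^ n))"
  proof (induction n)
    case (Suc n)
    then show ?case
      using step[of "r / 4 ^ Suc n"] assms by simp
  qed simp
  \<comment> \<open>\<open>G\<close> takes values in [0, 1] on positive arguments, so the bound is
    uniform in r and n.\<close>
  also have "\<dots> \<le> 4 / 3 * (1 - 0)"
    using assms by (intro mult_left_mono diff_mono) (auto simp: G_def)
  finally show ?thesis by simp
qed

section \<open>Geometry of the matrices \<open>B j k\<close>\<close>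

text \<open>\<open>matrix_inv\<close> is a choice among two-sided inverses: the diagonal matrix
  shows that one exists, and associativity identifies the chosen one with it.\<close>

lemma matrix_inv_dil:
  "matrix_inv (dil j) = vector [vector [1 / 4 ^ j, 0], vector [0, 1 / 2 ^ j]]" (is "_ = ?X")
proof -
  have "dil j ** ?X = mat 1" "?X ** dil j = mat 1"
    by (simp_all add: dil_def vec_eq_iff forall_2 matrix_matrix_mult_def sum_2 mat_def)
  then have "dil j ** matrix_inv (dil j) = mat 1 \<and> matrix_inv (dil j) ** dil j = mat 1"
    unfolding matrix_inv_def by (intro someI[where P = "\<lambda>A. dil j ** A = mat 1 \<and> A ** dil j = mat 1"] conjI)
  then have inv: "matrix_inv (dil j) ** dil j = mat 1" ..
  have "matrix_inv (dil j) = matrix_inv (dil j) ** (dil j ** ?X)"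
    by (simp add: \<open>dil j ** ?X = mat 1\<close>)
  also have "\<dots> = ?X"
    by (simp add: matrix_mul_assoc inv)
  finally show ?thesis .
qed

text \<open>The rotation adds to the polar angle. The factor 1 / 2^j is written as 2^j / 4^j so that
  both coordinates share the radius r / 4^j.\<close>

lemma B_polar:
  fixes \<xi> :: "real^2"
  assumes "\<xi> $ 1 = r * cos \<phi>" "\<xi> $ 2 = r * sin \<phi>"
  shows "(B j k *v \<xi>) $ 1 = r / 4 ^ j * cos (\<phi> + 2 * real k * pi / 2 ^ j)"
    and "(B j k *v \<xi>) $ 2 = 2 ^ j * (r / 4 ^ j) * sin (\<phi> + 2 * real k * pi / 2 ^ j)"
proof -
  have four: "(4::real) ^ j = 2 ^ j * 2 ^ j"
    by (simp flip: power_mult_distrib)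
  show "(B j k *v \<xi>) $ 1 = r / 4 ^ j * cos (\<phi> + 2 * real k * pi / 2 ^ j)"
    and "(B j k *v \<xi>) $ 2 = 2 ^ j * (r / 4 ^ j) * sin (\<phi> + 2 * real k * pi / 2 ^ j)"
    unfolding B_def matrix_inv_dil cos_add sin_add
    by (simp_all add: rot_def matrix_vector_mult_def matrix_matrix_mult_def sum_2 assms four field_simps)
qed

text \<open>As N >= 1, s is at most |x1| + |x2|, so the numerator is at most |x1| + 2 |x2|, hence at
  most 3 times the norm.\<close>

lemma anisotropic_norm_ge:
  fixes x :: "real^2"
  assumes "0 \<le> s" "1 \<le> N" "x $ 1 = s * cos \<alpha>" "x $ 2 = N * s * sin \<alpha>"
  shows "(s + N * s * \<bar>sin \<alpha>\<bar>) / 4 \<le> norm x"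
proof -
  have "s\<^sup>2 = (s * cos \<alpha>)\<^sup>2 + (s * sin \<alpha>)\<^sup>2"
    by (simp add: power_mult_distrib flip: distrib_left)
  also have "\<dots> \<le> (s * \<bar>cos \<alpha>\<bar> + s * \<bar>sin \<alpha>\<bar>)\<^sup>2"
    using assms by (simp add: power2_sum power_mult_distrib)
  finally have "s \<le> s * \<bar>cos \<alpha>\<bar> + s * \<bar>sin \<alpha>\<bar>"
    using assms by (auto dest!: power2_le_imp_le)
  also have "\<dots> \<le> s * \<bar>cos \<alpha>\<bar> + N * s * \<bar>sin \<alpha>\<bar>"
    using assms by (auto intro!: mult_right_mono simp: mult_le_cancel_right1)
  finally have "s \<le> \<bar>x $ 1\<bar> + \<bar>x $ 2\<bar>"
    using assms by (simp add: abs_mult)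
  moreover have "N * s * \<bar>sin \<alpha>\<bar> = \<bar>x $ 2\<bar>"
    using assms by (simp add: abs_mult)
  ultimately show ?thesis
    using component_le_norm_cart[of x 1] component_le_norm_cart[of x 2] by simp
qed

section \<open>Summation over directions and scales\<close>

text \<open>The norm bound splits the exponential decay into a radial factor and one depending on
  the sine of the angle; only the latter varies with k, since the power is bounded through |x1| <=
  s.\<close>

lemma level_sum_le:
  fixes f :: "real^2 \<Rightarrow> complex" and \<xi> :: "real^2"
  assumes "0 < \<epsilon>" "0 < \<tau>" "1 \<le> j" "0 < r" "0 \<le> \<phi>"
    and \<xi>: "\<xi> $ 1 = r * cos \<phi>" "\<xi> $ 2 = r * sin \<phi>"
    and f: "\<And>x. norm (f x) \<le> \<bar>x $ 1\<bar> powr (2 + \<epsilon>) * exp (- \<tau> * norm x)"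
  defines "s \<equiv> r / 4 ^ j"
  shows "(\<Sum>k<2 ^ j. norm (f (B j k *v \<xi>)))
      \<le> s powr (2 + \<epsilon>) * exp (- (\<tau> / 4) * s) * (4 * (1 + 1 / (\<tau> * s)))"
proof -
  define \<alpha> where "\<alpha> k = \<phi> + 2 * real k * pi / 2 ^ j" for k
  define a where "a = \<tau> / 4 * (2 ^ j * s)"
  have s: "0 < s"
    using assms by (simp add: s_def)
  then have a: "0 < a"
    using assms by (simp add: a_def)
  obtain i where i: "j = Suc i"
    using assms by (cases j) auto
  \<comment> \<open>The 2^j directions are 2 M angles of spacing pi / M with M = 2^(j - 1).\<close>
  have \<alpha>: "\<alpha> k = \<phi> + pi * real k / real (2 ^ i)" for k
    by (simp add: \<alpha>_def i)
  have "norm (f (B j k *v \<xi>)) \<le> s powr (2 + \<epsilon>) * exp (- (\<tau> / 4) * s) * exp (- a * \<bar>sin (\<alpha> k)\<bar>)" for k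
  proof -
    let ?x = "B j k *v \<xi>"
    have x: "?x $ 1 = s * cos (\<alpha> k)" "?x $ 2 = 2 ^ j * s * sin (\<alpha> k)"
      unfolding s_def \<alpha>_def by (rule B_polar[OF \<xi>])+
    have "\<tau> * ((s + 2 ^ j * s * \<bar>sin (\<alpha> k)\<bar>) / 4) \<le> \<tau> * norm ?x"
      using assms s by (intro mult_left_mono anisotropic_norm_ge[OF _ _ x]) auto
    then have "exp (- \<tau> * norm ?x) \<le> exp (- (\<tau> / 4) * s + - a * \<bar>sin (\<alpha> k)\<bar>)"
      by (simp add: a_def algebra_simps)
    also have "\<dots> = exp (- (\<tau> / 4) * s) * exp (- a * \<bar>sin (\<alpha> k)\<bar>)"
      by (rule exp_add)
    finally have e: "exp (- \<tau> * norm ?x) \<le> \<dots>" .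
    have "\<bar>?x $ 1\<bar> \<le> s"
      using s by (simp add: x abs_mult)
    then have "\<bar>?x $ 1\<bar> powr (2 + \<epsilon>) \<le> s powr (2 + \<epsilon>)"
      using assms by (intro powr_mono2) auto
    with e have "\<bar>?x $ 1\<bar> powr (2 + \<epsilon>) * exp (- \<tau> * norm ?x)
        \<le> s powr (2 + \<epsilon>) * (exp (- (\<tau> / 4) * s) * exp (- a * \<bar>sin (\<alpha> k)\<bar>))"
      by (intro mult_mono) auto
    with f[of ?x] show ?thesis
      by (simp add: mult.assoc)
  qed
  then have "(\<Sum>k<2 ^ j. norm (f (B j k *v \<xi>)))
      \<le> s powr (2 + \<epsilon>) * exp (- (\<tau> / 4) * s) * (\<Sum>k<2 ^ j. exp (- a * \<bar>sin (\<alpha> k)\<bar>))"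
    unfolding sum_distrib_left by (intro sum_mono)
  also have "(\<Sum>k<2 ^ j. exp (- a * \<bar>sin (\<alpha> k)\<bar>)) \<le> 4 * (1 + real (2 ^ i) / (2 * a))"
    using sum_exp_abs_sin_le[OF a _ \<open>0 \<le> \<phi>\<close>, of "2 ^ i"] by (simp add: \<alpha> i)
  \<comment> \<open>The stretching factor 2^j inside \<open>a\<close> offsets the number of
    directions, so the bound depends on j only through s.\<close>
  also have "real (2 ^ i) / (2 * a) = 1 / (\<tau> * s)"
    using assms(2) s by (simp add: a_def i field_simps)
  finally show ?thesis
    by (simp add: mult_left_mono)
qed

theorem proposition2p3:
  fixes \<epsilon> \<tau> :: real
  assumes "\<epsilon> > 0" and "\<tau> > 0"
  shows "\<exists>C::real. \<forall>f :: real^2 \<Rightarrow> complex.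
           (\<forall>\<xi>. norm (f \<xi>) \<le> \<bar>\<xi> $ 1\<bar> powr (2 + \<epsilon>) * exp (- \<tau> * norm \<xi>))
             \<longrightarrow> star_norm f \<le> ennreal C"
proof -
  obtain K where K: "0 \<le> K"
    "\<And>s. 0 < s \<Longrightarrow> s powr (2 + \<epsilon>) * exp (- (\<tau> / 4) * s) * (4 * (1 + 1 / (\<tau> * s))) \<le> K * (s / (1 + s)\<^sup>2)"
    using level_bound_exists[OF assms] by blast
  have "star_norm f \<le> ennreal (K * (4 / 3))"
    if f: "\<forall>\<xi>. norm (f \<xi>) \<le> \<bar>\<xi> $ 1\<bar> powr (2 + \<epsilon>) * exp (- \<tau> * norm \<xi>)" for f :: "real^2 \<Rightarrow> complex"
  proof -
    define S where "S \<xi> j = (\<Sum>k<2 ^ j. norm (f (B j k *v \<xi>)))" for \<xi> j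
    have S: "(\<Sum>k=0..2 ^ j - 1. ennreal (norm (f (B j k *v \<xi>)))) = ennreal (S \<xi> j)" for \<xi> j
    proof -
      have "{0..2 ^ j - 1} = {..<2 ^ j :: nat}"
        by (simp add: atLeast0AtMost flip: lessThan_Suc_atMost)
      then show ?thesis
        by (simp add: S_def)
    qed
    have S_nonneg: "0 \<le> S \<xi> j" for \<xi> j
      by (simp add: S_def sum_nonneg)
    have partial: "(\<Sum>j=1..n. S \<xi> j) \<le> K * (4 / 3)" for \<xi> n
    proof (cases "\<xi> = 0")
      \<comment> \<open>At the origin there is no radius to divide by, but \<open>f 0 = 0\<close>
        because \<open>0 powr (2 + \<epsilon>) = 0\<close>.\<close>
      case True
      then have "S \<xi> j = 0" for j
        using f[rule_format, of 0] by (simp add: S_def)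
      then show ?thesis
        using K(1) by simp
    next
      case False
      define r where "r = norm \<xi>"
      have r: "0 < r"
        using False by (simp add: r_def)
      have "(\<xi> $ 1)\<^sup>2 + (\<xi> $ 2)\<^sup>2 = r\<^sup>2"
        by (simp add: r_def norm_vec_def L2_set_def sum_2)
      then have "(\<xi> $ 1 / r)\<^sup>2 + (\<xi> $ 2 / r)\<^sup>2 = 1"
        using r by (simp add: power_divide flip: add_divide_distrib)
      then obtain \<phi> where "0 \<le> \<phi>" "\<xi> $ 1 / r = cos \<phi>" "\<xi> $ 2 / r = sin \<phi>"
        by (rule sincos_total_2pi)
      then have \<phi>: "0 \<le> \<phi>" "\<xi> $ 1 = r * cos \<phi>" "\<xi> $ 2 = r * sin \<phi>"
        using r by (auto simp: field_simps)
      have "S \<xi> j \<le> K * ((r / 4 ^ j) / (1 + r / 4 ^ j)\<^sup>2)" if "1 \<le> j" for j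
      proof -
        have "S \<xi> j \<le> (r / 4 ^ j) powr (2 + \<epsilon>) * exp (- (\<tau> / 4) * (r / 4 ^ j)) * (4 * (1 + 1 / (\<tau> * (r / 4 ^ j))))"
          unfolding S_def using f by (intro level_sum_le[OF assms that r \<phi>]) simp
        also have "\<dots> \<le> K * ((r / 4 ^ j) / (1 + r / 4 ^ j)\<^sup>2)"
          using r by (intro K(2)) auto
        finally show ?thesis .
      qed
      then have "(\<Sum>j=1..n. S \<xi> j) \<le> K * (\<Sum>j=1..n. (r / 4 ^ j) / (1 + r / 4 ^ j)\<^sup>2)"
        unfolding sum_distrib_left by (intro sum_mono) auto
      also have "\<dots> \<le> K * (4 / 3)"
        using sum_powers_of_4_le[OF r] K(1) by (rule mult_left_mono)
      finally show ?thesis .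
    qed
    have "(\<Sum>\<^sub>\<infinity>j\<in>{1..}. ennreal (S \<xi> j)) \<le> ennreal (K * (4 / 3))" for \<xi>
    proof -
      \<comment> \<open>The infinite sum in \<open>ennreal\<close> is the supremum of its finite
        subsums, and each finite index set lies in an initial segment.\<close>
      have "(\<Sum>j\<in>A. ennreal (S \<xi> j)) \<le> ennreal (K * (4 / 3))" if A: "finite A" "A \<subseteq> {1..}" for A
      proof -
        have "A \<subseteq> {1..Max A}"
          using A by auto
        then have "(\<Sum>j\<in>A. S \<xi> j) \<le> (\<Sum>j=1..Max A. S \<xi> j)"
          by (intro sum_mono2) (auto simp: S_nonneg)
        with partial[of \<xi> "Max A"] have "(\<Sum>j\<in>A. S \<xi> j) \<le> K * (4 / 3)"
          by linarith
        then show ?thesis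
          by (simp add: S_nonneg ennreal_leI)
      qed
      then show ?thesis
        by (simp only: nonneg_infsum_complete zero_le) (rule SUP_least, blast)
    qed
    \<comment> \<open>The bound holds at every point, so the constant belongs to the set whose
      infimum is the essential supremum.\<close>
    then show ?thesis
      unfolding star_norm_def ess_sup_def S by (intro Inf_lower) simp
  qed
  then show ?thesis
    by blast
qed

end
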